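(* Let $g:\mathbb{R}^{nm}\to(-\infty,+\infty]$ be given by $g(\boldsymbol t)=\lambda\boldsymbol c^T\boldsymbol t$ if $\boldsymbol t\in\mathbb{R}^{nm}_+$ and $g(\boldsymbol t)=+\infty$ otherwise, and let $h(\boldsymbol z)=D_\phi(\boldsymbol z,\boldsymbol y)$ for $\boldsymbol z\in\mathbb{R}^{n+m}$, so that the unbalanced optimal transport (UOT) problem is $\min_{\boldsymbol t} g(\boldsymbol t)+h(\mathbf X\boldsymbol t)$. Then its Fenchel--Rockafellar dual problem $\max_{\boldsymbol\theta\in\mathbb{R}^{n+m}} -h^*(-\boldsymbol\theta)-g^*(\mathbf X^T\boldsymbol\theta)$ is $$\max_{\boldsymbol\theta\in\mathbb{R}^{n+m}} \; -D_\phi^*(-\boldsymbol\theta)\quad\text{subject to}\quad \boldsymbol x_p^T\boldsymbol\theta-\lambda c_p\le 0\ \text{ for all } p\in\{0,\dots,nm-1\},$$ that is, $-h^*(-\boldsymbol\theta)-g^*(\mathbf X^T\boldsymbol\theta)$ equals $-D_\phi^*(-\boldsymbol\theta)$ if $\boldsymbol\theta$ satisfies all these constraints, and equals $-\infty$ otherwise.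
   Context: Let $m,n\ge1$, $\lambda>0$, a cost vector $\boldsymbol c\in\mathbb{R}^{nm}_+$ and $\boldsymbol y=[\boldsymbol a^T,\boldsymbol b^T]^T\in\mathbb{R}^{m+n}$ with $\boldsymbol a\in\mathbb{R}^m$, $\boldsymbol b\in\mathbb{R}^n$ be given. All indices start at $0$. A transport matrix $\mathbf T\in\mathbb{R}^{m\times n}_+$ is flattened row by row into $\boldsymbol t\in\mathbb{R}^{nm}_+$: $t_{un+v}=T_{u,v}$ for $0\le u<m$, $0\le v<n$; the cost matrix is flattened to $\boldsymbol c$ in the same way. The index matrix $\mathbf X\in\{0,1\}^{(m+n)\times nm}$ is the matrix such that $\mathbf X\boldsymbol t$ lists the $m$ row sums followed by the $n$ column sums of $\mathbf T$; its $p$-th column, with $p=un+v$, is denoted $\boldsymbol x_p$ and has exactly two entries equal to $1$, at positions $u$ and $m+v$. $D_\phi$ is a divergence: $D_\phi(\boldsymbol z,\boldsymbol y)=\sum_i[\phi(z_i)-\phi(y_i)-\phi'(y_i)(z_i-y_i)]$ with $\phi$ strictly convex and differentiable, regarded as a proper convex function of $\boldsymbol z$ with values in $(-\infty,+\infty]$. The UOT problem is $\min_{\boldsymbol t\in\mathbb{R}^{nm}_+}\lambda\boldsymbol c^T\boldsymbol t+D_\phi(\mathbf X\boldsymbol t,\boldsymbol y)$. For a function $f$, $f^*(\boldsymbol\theta)=\sup_{\boldsymbol z}(\boldsymbol\theta^T\boldsymbol z-f(\boldsymbol z))$ is its convex conjugate; $D_\phi^*$ denotes the convex conjugate of $\boldsymbol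 z\mapsto D_\phi(\boldsymbol z,\boldsymbol y)$. *)

theory Defs
  imports
    "HOL-Analysis.Derivative"
    "HOL-Library.Extended_Real"
    "Jordan_Normal_Form.Matrix"
begin

unbundle no inner_syntax

definition nonneg_orthant :: "nat \<Rightarrow> real vec set" where
  "nonneg_orthant d = {t \<in> carrier_vec d. 0\<^sub>v d \<le> t}"

text \<open>A vector in $\mathbb{R}^d$ is an element of \<^term>\<open>carrier_vec d\<close>; functions with values in
  $(-\infty,+\infty]$ are only looked at on that carrier, hence the dimension argument.\<close>

definition convex_conjugate :: "nat \<Rightarrow> (real vec \<Rightarrow> ereal) \<Rightarrow> real vec \<Rightarrow> ereal" where
  "convex_conjugate d f \<theta> = (SUP z\<in>carrier_vec d. ereal (\<theta> \<bullet> z) - f z)"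

definition fr_primal ::
  "(real vec \<Rightarrow> ereal) \<Rightarrow> (real vec \<Rightarrow> ereal) \<Rightarrow> real mat \<Rightarrow> real vec \<Rightarrow> ereal" where
  "fr_primal g h A t = g t + h (A *\<^sub>v t)"

definition fr_dual ::
  "(real vec \<Rightarrow> ereal) \<Rightarrow> (real vec \<Rightarrow> ereal) \<Rightarrow> real mat \<Rightarrow> real vec \<Rightarrow> ereal" where
  "fr_dual g h A \<theta> =
    - convex_conjugate (dim_row A) h (- \<theta>)
    - convex_conjugate (dim_col A) g (transpose_mat A *\<^sub>v \<theta>)"

text \<open>The generator takes the value $+\infty$ outside its effective domain, as does
  $x \log x - x$ on the negative half-line.\<close>

definition eff_domain :: "(real \<Rightarrow> ereal) \<Rightarrow> real set" where
  "eff_domain \<phi> = {x. \<phi> x < \<infinity>}"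

text \<open>The strict inequality makes the effective domain convex.\<close>

definition strictly_convex :: "(real \<Rightarrow> ereal) \<Rightarrow> bool" where
  "strictly_convex \<phi> \<longleftrightarrow>
    (\<forall>x. \<phi> x \<noteq> - \<infinity>) \<and>
    (\<forall>x \<in> eff_domain \<phi>. \<forall>y \<in> eff_domain \<phi>. \<forall>s. x \<noteq> y \<longrightarrow> 0 < s \<longrightarrow> s < 1 \<longrightarrow>
      \<phi> ((1 - s) * x + s * y) < ereal (1 - s) * \<phi> x + ereal s * \<phi> y)"

text \<open>Differentiability within the effective domain: the usual notion in its interior, one-sided
  at an end point that belongs to it.\<close>

definition differentiable_gen_at :: "(real \<Rightarrow> ereal) \<Rightarrow> real \<Rightarrow> bool" where
  "differentiable_gen_at \<phi> x \<longleftrightarrow>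
    x \<in> eff_domain \<phi> \<and> (\<lambda>u. real_of_ereal (\<phi> u)) differentiable (at x within eff_domain \<phi>)"

definition gen_deriv :: "(real \<Rightarrow> ereal) \<Rightarrow> real \<Rightarrow> real" where
  "gen_deriv \<phi> x = vector_derivative (\<lambda>u. real_of_ereal (\<phi> u)) (at x within eff_domain \<phi>)"

definition divergence :: "(real \<Rightarrow> ereal) \<Rightarrow> real vec \<Rightarrow> real vec \<Rightarrow> ereal" where
  "divergence \<phi> z y =
    (\<Sum>i<dim_vec y. \<phi> (z $ i) - \<phi> (y $ i) - ereal (gen_deriv \<phi> (y $ i) * (z $ i - y $ i)))"

definition divergence_conjugate :: "(real \<Rightarrow> ereal) \<Rightarrow> real vec \<Rightarrow> real vec \<Rightarrow> ereal" where
  "divergence_conjugate \<phi> y = convex_conjugate (dim_vec y) (\<lambda>z. divergence \<phi> z y)"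

definition flatten :: "real mat \<Rightarrow> real vec" where
  "flatten T = vec (dim_col T * dim_row T) (\<lambda>p. T $$ (p div dim_col T, p mod dim_col T))"

definition index_matrix :: "nat \<Rightarrow> nat \<Rightarrow> real mat" where
  "index_matrix m n =
    mat (m + n) (n * m) (\<lambda>(i, p). if i = p div n \<or> i = m + p mod n then 1 else 0)"

lemma div_mod_less:
  assumes "p < n * (m::nat)"
  shows "p div n < m" "p mod n < n"
proof -
  have "n > 0" using assms by (cases n) auto
  then show "p div n < m" "p mod n < n"
    using assms by (auto simp: less_mult_imp_div_less mult.commute)
qed

lemma flatten_index:
  assumes "T \<in> carrier_mat m n" "u < m" "v < n"
  shows "flatten T $ (u * n + v) = T $$ (u, v)"
proof -
  have "u * n + v < Suc u * n" using assms by simp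
  also have "\<dots> \<le> m * n" using assms by (intro mult_le_mono1) simp
  finally show ?thesis using assms by (simp add: flatten_def mult.commute)
qed

lemma col_index_matrix:
  assumes "u < m" "v < n"
  shows "col (index_matrix m n) (u * n + v) = unit_vec (m + n) u + unit_vec (m + n) (m + v)"
proof -
  have "u * n + v < Suc u * n" using assms by simp
  also have "\<dots> \<le> m * n" using assms by (intro mult_le_mono1) simp
  finally have "u * n + v < n * m" by (simp add: mult.commute)
  with assms show ?thesis
    by (intro eq_vecI) (auto simp: index_matrix_def unit_vec_def)
qed

lemma sum_flat:
  fixes f :: "nat \<Rightarrow> nat \<Rightarrow> real"
  shows "(\<Sum>p<n*m. f (p div n) (p mod n)) = (\<Sum>u<m. \<Sum>v<n. f u v)"
proof -
  have "(\<Sum>u<m. \<Sum>v<n. f u v) = (\<Sum>(u,v)\<in>{..<m}\<times>{..<n}. f u v)"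
    by (simp add: sum.cartesian_product)
  also have "\<dots> = (\<Sum>p<n*m. f (p div n) (p mod n))"
  proof (rule sum.reindex_bij_witness[where j = "\<lambda>(u,v). u * n + v" and i = "\<lambda>p. (p div n, p mod n)"])
    fix a assume "a \<in> {..<m} \<times> {..<n}"
    then obtain u v where a: "a = (u, v)" "u < m" "v < n" by auto
    have "u * n + v < Suc u * n" using a by simp
    also have "\<dots> \<le> m * n" using a by (intro mult_le_mono1) simp
    finally show "(case a of (u, v) \<Rightarrow> u * n + v) \<in> {..<n*m}" using a by (simp add: mult.commute)
  qed (auto simp: div_mod_less)
  finally show ?thesis by simp
qed

lemma index_matrix_mult_flatten:
  assumes T: "T \<in> carrier_mat m n"
  shows "index_matrix m n *\<^sub>v flatten T =
    vec m (\<lambda>u. \<Sum>v<n. T $$ (u, v)) @\<^sub>v vec n (\<lambda>v. \<Sum>u<m. T $$ (u, v))" (is "?l = ?r")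
proof (rule eq_vecI)
  show "dim_vec ?l = dim_vec ?r" by (simp add: index_matrix_def)
  fix i assume "i < dim_vec ?r"
  then have i: "i < m + n" by simp
  have "?l $ i = (\<Sum>p<n*m. (if i = p div n \<or> i = m + p mod n then 1 else 0) * T $$ (p div n, p mod n))"
    using i T by (auto simp: index_matrix_def flatten_def scalar_prod_def lessThan_atLeast0 intro!: sum.cong)
  also have "\<dots> = (\<Sum>u<m. \<Sum>v<n. (if i = u \<or> i = m + v then 1 else 0) * T $$ (u, v))"
    by (rule sum_flat[where f = "\<lambda>u v. (if i = u \<or> i = m + v then 1 else 0) * T $$ (u, v)"])
  also have "\<dots> = ?r $ i"
  proof (cases "i < m")
    case True
    then have "(\<Sum>u<m. \<Sum>v<n. (if i = u \<or> i = m + v then 1 else 0) * T $$ (u, v))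
      = (\<Sum>u<m. if i = u then (\<Sum>v<n. T $$ (u, v)) else 0)"
      by (intro sum.cong) auto
    with True show ?thesis by simp
  next
    case False
    have "(\<Sum>v<n. (if i = u \<or> i = m + v then 1 else 0) * T $$ (u, v)) = T $$ (u, i - m)"
      if "u < m" for u
    proof -
      have "(\<Sum>v<n. (if i = u \<or> i = m + v then 1 else 0) * T $$ (u, v))
        = (\<Sum>v<n. if i - m = v then T $$ (u, v) else 0)"
        using that False by (intro sum.cong) auto
      also have "\<dots> = T $$ (u, i - m)" using i False by simp
      finally show ?thesis .
    qed
    with False i show ?thesis by simp
  qed
  finally show "?l $ i = ?r $ i" .
qed

end

theory Submission
  imports Defs
begin

text \<open>The cost is a linear function plus the indicator of the nonnegative orthant, and the
  conjugate of such a function is an indicator as well: the supremum of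
  $(w - q) \cdot t$ over $t \ge 0$ is $0$, attained at the origin, if no coordinate of $w - q$ is
  positive, and otherwise it is $+\infty$, along the ray spanned by the unit vector of a positive
  coordinate (\<open>convex_conjugate_linear_on_orthant\<close>). At $w = X^T \theta$ and $q = \lambda c$ the
  coordinates of $w - q$ are the left-hand sides of the dual constraints, because
  $(X^T \theta)_p = x_p \cdot \theta$. So $-g^*(X^T \theta)$ contributes nothing at a feasible
  $\theta$ and $-\infty$ at any other.

  What remains is the arithmetic of infinite values. At an infeasible $\theta$ the dual objective
  is $-h^*(-\theta) - \infty$, which is $-\infty$ unless $h^*(-\theta) = -\infty$. The latter
  cannot happen once $h$ is different from $+\infty$ at some point
  (\<open>convex_conjugate_not_MInfty\<close>). For the divergence that point is $y$, at which it vanishes: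
  the generator is finite at each entry of $y$.\<close>

lemma smult_unit_vec_in_nonneg_orthant:
  assumes "0 \<le> k"
  shows "k \<cdot>\<^sub>v unit_vec d p \<in> nonneg_orthant d"
  using assms by (auto simp: nonneg_orthant_def less_eq_vec_def unit_vec_def)

text \<open>The value at the origin bounds the conjugate below by $0$, and the
  coordinate rays decide whether it is larger, since they generate the orthant.\<close>

lemma convex_conjugate_linear_on_orthant:
  fixes q w :: "real vec"
  assumes q: "q \<in> carrier_vec d" and w: "w \<in> carrier_vec d"
    and g: "\<And>t. t \<in> carrier_vec d \<Longrightarrow>
      g t = (if t \<in> nonneg_orthant d then ereal (q \<bullet> t) else \<infinity>)"
  shows "convex_conjugate d g w = (if \<forall>p<d. w $ p \<le> q $ p then 0 else \<infinity>)"
proof (cases "\<forall>p<d. w $ p \<le> q $ p")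
  case True
  have "ereal (w \<bullet> t) - g t \<le> 0" if t: "t \<in> carrier_vec d" for t
  proof (cases "t \<in> nonneg_orthant d")
    case orthant: True
    have "w \<bullet> t \<le> q \<bullet> t"
      unfolding scalar_prod_def using True t orthant
      by (intro sum_mono mult_right_mono) (auto simp: nonneg_orthant_def less_eq_vec_def)
    with orthant show ?thesis using g[OF t] by simp
  qed (simp add: g t)
  moreover have "0\<^sub>v d \<in> nonneg_orthant d"
    by (simp add: nonneg_orthant_def)
  then have "ereal (w \<bullet> 0\<^sub>v d) - g (0\<^sub>v d) = 0"
    using q w g[of "0\<^sub>v d"] by simp
  ultimately have "convex_conjugate d g w = 0"
    unfolding convex_conjugate_def
    by (intro antisym SUP_least SUP_upper2[of "0\<^sub>v d"]) auto
  with True show ?thesis by simp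
next
  case False
  then obtain p where p: "p < d" "q $ p < w $ p" by force
  have "\<exists>t\<in>carrier_vec d. ereal (real N) \<le> ereal (w \<bullet> t) - g t" for N :: nat
  proof -
    \<comment> \<open>This multiple of the unit vector makes the linear function $w - q$ equal to $N$.\<close>
    define k where "k = real N / (w $ p - q $ p)"
    define t where "t = k \<cdot>\<^sub>v unit_vec d p"
    have t: "t \<in> carrier_vec d" "t \<in> nonneg_orthant d"
      using p by (auto simp: t_def k_def intro!: smult_unit_vec_in_nonneg_orthant)
    have "w \<bullet> t - q \<bullet> t = k * (w $ p - q $ p)"
      using p q w by (simp add: t_def algebra_simps)
    also have "\<dots> = real N" using p by (simp add: k_def)
    finally show ?thesis using t g[OF t(1)] by (intro bexI[of _ t]) auto
  qed
  then have "convex_conjugate d g w = \<infinity>"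
    unfolding convex_conjugate_def by (intro SUP_PInfty)
  with False show ?thesis by auto
qed

lemma convex_conjugate_not_MInfty:
  assumes "z \<in> carrier_vec d" and "f z \<noteq> \<infinity>"
  shows "convex_conjugate d f \<theta> \<noteq> - \<infinity>"
proof -
  have "ereal (\<theta> \<bullet> z) - f z \<le> convex_conjugate d f \<theta>"
    unfolding convex_conjugate_def using assms(1) by (rule SUP_upper)
  with assms(2) show ?thesis by (cases "f z") auto
qed

text \<open>Linear programming duality for $\min\, q \cdot t$ over $A t = b$, $t \ge 0$, is the case
  where $h$ is the indicator of $b$; a general $h$ changes the objective of the dual, while its
  constraints $A^T \theta \le q$ stem from the orthant alone. The point $z$ excludes
  $\infty - \infty$ in the dual objective.\<close>

lemma fr_dual_linear_on_orthant:
  fixes A :: "real mat" and q \<theta> :: "real vec"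
  assumes A: "A \<in> carrier_mat k d" and q: "q \<in> carrier_vec d"
    and g: "\<And>t. t \<in> carrier_vec d \<Longrightarrow>
      g t = (if t \<in> nonneg_orthant d then ereal (q \<bullet> t) else \<infinity>)"
    and z: "z \<in> carrier_vec k" "h z \<noteq> \<infinity>"
  shows "fr_dual g h A \<theta> =
    (if \<forall>p<d. col A p \<bullet> \<theta> \<le> q $ p then - convex_conjugate k h (- \<theta>) else - \<infinity>)"
proof -
  have "convex_conjugate d g (transpose_mat A *\<^sub>v \<theta>) =
      (if \<forall>p<d. (transpose_mat A *\<^sub>v \<theta>) $ p \<le> q $ p then 0 else \<infinity>)"
  proof (rule convex_conjugate_linear_on_orthant[OF q])
    show "transpose_mat A *\<^sub>v \<theta> \<in> carrier_vec d"
      using A by (intro carrier_vecI) simp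
  qed (rule g)
  also have "(\<forall>p<d. (transpose_mat A *\<^sub>v \<theta>) $ p \<le> q $ p) \<longleftrightarrow>
      (\<forall>p<d. col A p \<bullet> \<theta> \<le> q $ p)"
    using A by auto
  finally have g_conj: "convex_conjugate d g (transpose_mat A *\<^sub>v \<theta>) =
      (if \<forall>p<d. col A p \<bullet> \<theta> \<le> q $ p then 0 else \<infinity>)" .
  have "convex_conjugate k h (- \<theta>) \<noteq> - \<infinity>"
    using z by (rule convex_conjugate_not_MInfty)
  then show ?thesis
    using A by (cases "convex_conjugate k h (- \<theta>)") (auto simp: fr_dual_def g_conj)
qed

lemma divergence_self:
  assumes "\<And>i. i < dim_vec y \<Longrightarrow> \<bar>\<phi> (y $ i)\<bar> \<noteq> \<infinity>"
  shows "divergence \<phi> y y = 0"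
  unfolding divergence_def using assms by (intro sum.neutral) auto

lemma SUP_if_MInfty:
  fixes f :: "'a \<Rightarrow> ereal"
  shows "(SUP x\<in>S. if P x then f x else - \<infinity>) = (SUP x\<in>{x \<in> S. P x}. f x)"
proof (rule antisym)
  show "(SUP x\<in>S. if P x then f x else - \<infinity>) \<le> (SUP x\<in>{x \<in> S. P x}. f x)"
    by (rule SUP_least) (auto intro: SUP_upper)
  show "(SUP x\<in>{x \<in> S. P x}. f x) \<le> (SUP x\<in>S. if P x then f x else - \<infinity>)"
    by (rule SUP_mono) auto
qed

lemma INF_if_PInfty:
  fixes f :: "'a \<Rightarrow> ereal"
  assumes "T \<subseteq> S"
  shows "(INF x\<in>S. if x \<in> T then f x else \<infinity>) = (INF x\<in>T. f x)"
proof (rule antisym)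
  show "(INF x\<in>S. if x \<in> T then f x else \<infinity>) \<le> (INF x\<in>T. f x)"
    using assms by (intro INF_mono) auto
  show "(INF x\<in>T. f x) \<le> (INF x\<in>S. if x \<in> T then f x else \<infinity>)"
    by (rule INF_greatest) (auto intro: INF_lower)
qed

theorem lemma4:
  fixes m n :: nat
    and lam :: real
    and a b c y :: "real vec"
    and \<phi> :: "real \<Rightarrow> ereal"
    and X :: "real mat"
    and g h :: "real vec \<Rightarrow> ereal"
  assumes "m \<ge> 1" and "n \<ge> 1" and "lam > 0"
    and "c \<in> nonneg_orthant (n * m)"
    and "a \<in> carrier_vec m" and "b \<in> carrier_vec n" and "y = a @\<^sub>v b"
    and "X = index_matrix m n"
    and "strictly_convex \<phi>"
    and "\<forall>x \<in> interior (eff_domain \<phi>). differentiable_gen_at \<phi> x"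
    and "\<forall>i < m + n. differentiable_gen_at \<phi> (y $ i)"
    and "\<forall>t \<in> carrier_vec (n * m).
      g t = (if t \<in> nonneg_orthant (n * m) then ereal (lam * (c \<bullet> t)) else \<infinity>)"
    and "\<forall>z \<in> carrier_vec (m + n). h z = divergence \<phi> z y"
  shows
    "(INF t\<in>carrier_vec (n * m). fr_primal g h X t)
       = (INF t\<in>nonneg_orthant (n * m). ereal (lam * (c \<bullet> t)) + divergence \<phi> (X *\<^sub>v t) y) \<and>
     (\<forall>t \<in> carrier_vec (n * m). fr_primal g h X t =
       (if t \<in> nonneg_orthant (n * m)
        then ereal (lam * (c \<bullet> t)) + divergence \<phi> (X *\<^sub>v t) y else \<infinity>)) \<and>
     (SUP \<theta>\<in>carrier_vec (m + n). fr_dual g h X \<theta>)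
       = (SUP \<theta>\<in>{\<theta> \<in> carrier_vec (m + n). \<forall>p < n * m. col X p \<bullet> \<theta> - lam * c $ p \<le> 0}.
            - divergence_conjugate \<phi> y (- \<theta>)) \<and>
     (\<forall>\<theta> \<in> carrier_vec (m + n). fr_dual g h X \<theta> =
       (if \<forall>p < n * m. col X p \<bullet> \<theta> - lam * c $ p \<le> 0
        then - divergence_conjugate \<phi> y (- \<theta>) else - \<infinity>))"
proof -
  have X: "X \<in> carrier_mat (m + n) (n * m)"
    using assms(8) by (simp add: index_matrix_def)
  have y: "y \<in> carrier_vec (m + n)"
    using assms(5-7) by simp
  have c: "c \<in> carrier_vec (n * m)"
    using assms(4) by (simp add: nonneg_orthant_def)
  have primal: "fr_primal g h X t =
      (if t \<in> nonneg_orthant (n * m)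
       then ereal (lam * (c \<bullet> t)) + divergence \<phi> (X *\<^sub>v t) y else \<infinity>)"
    if "t \<in> carrier_vec (n * m)" for t
    using that X assms(12,13) by (simp add: fr_primal_def)
  have "\<bar>\<phi> (y $ i)\<bar> \<noteq> \<infinity>" if "i < dim_vec y" for i
    using that y assms(9,11)
    by (auto simp: differentiable_gen_at_def eff_domain_def strictly_convex_def)
  then have "divergence \<phi> y y = 0"
    by (rule divergence_self)
  then have hy: "h y \<noteq> \<infinity>"
    using y assms(13) by simp
  have g: "g t = (if t \<in> nonneg_orthant (n * m) then ereal ((lam \<cdot>\<^sub>v c) \<bullet> t) else \<infinity>)"
    if "t \<in> carrier_vec (n * m)" for t
    using that c assms(12) by simp
  have conj_h: "convex_conjugate (m + n) h = divergence_conjugate \<phi> y"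
    using y assms(13) by (auto simp: divergence_conjugate_def convex_conjugate_def fun_eq_iff)
  have dual: "fr_dual g h X \<theta> =
      (if \<forall>p < n * m. col X p \<bullet> \<theta> - lam * c $ p \<le> 0
       then - divergence_conjugate \<phi> y (- \<theta>) else - \<infinity>)" for \<theta>
    using fr_dual_linear_on_orthant[where q = "lam \<cdot>\<^sub>v c" and g = g and h = h and z = y
        and \<theta> = \<theta>, OF X _ g y hy] c
    by (auto simp: conj_h)
  have orthant: "nonneg_orthant (n * m) \<subseteq> carrier_vec (n * m)"
    by (auto simp: nonneg_orthant_def)
  show ?thesis
  proof (intro conjI ballI)
    show "(INF t\<in>carrier_vec (n * m). fr_primal g h X t) =
        (INF t\<in>nonneg_orthant (n * m). ereal (lam * (c \<bullet> t)) + divergence \<phi> (X *\<^sub>v t) y)"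
      unfolding INF_if_PInfty[OF orthant, symmetric] by (rule INF_cong[OF refl primal])
    show "(SUP \<theta>\<in>carrier_vec (m + n). fr_dual g h X \<theta>) =
        (SUP \<theta>\<in>{\<theta> \<in> carrier_vec (m + n). \<forall>p < n * m. col X p \<bullet> \<theta> - lam * c $ p \<le> 0}.
          - divergence_conjugate \<phi> y (- \<theta>))"
      unfolding SUP_if_MInfty[symmetric] by (rule SUP_cong[OF refl dual])
  qed (erule primal, rule dual)
qed

end
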